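(* Let $(\mathcal{M}, f, g)$ and $(\mathcal{N}, f', g')$ be free $(1,1)$-magmas with generating sets $X_{\mathcal{M}}$ and $X_{\mathcal{N}}$ respectively, with $|X_{\mathcal{M}}| = |X_{\mathcal{N}}|$, let $\sigma : X_{\mathcal{M}} \to X_{\mathcal{N}}$ be any bijection, and let $\Upsilon : \mathcal{M} \to \mathcal{N}$ be the associated universal bijection map. Then $\Upsilon$ is a $(1,1)$-magma isomorphism.
   Context: A $(1,1)$-magma is a triple $(\mathcal{M}, f, g)$ with $\mathcal{M}$ a non-empty countable set and $f, g : \mathcal{M} \to \mathcal{M}$ two unary maps (in a fixed order). A morphism from $(\mathcal{M}, f, g)$ to $(\mathcal{N}, f', g')$ is a map $\theta : \mathcal{M} \to \mathcal{N}$ with $\theta(f(m)) = f'(\theta(m))$ and $\theta(g(m)) = g'(\theta(m))$ for all $m \in \mathcal{M}$; an isomorphism is a bijective morphism. $(\mathcal{M}, f, g)$ is free if there exist a set $Y$ and a map $i : Y \to \mathcal{M}$ such that for every $(1,1)$-magma $(\mathcal{N}, f', g')$ and every map $\varphi : Y \to \mathcal{N}$ there exists a unique morphism $\theta : \mathcal{M} \to \mathcal{N}$ with $\varphi = \theta \circ i$; the image $i(Y)$ is called the generating set of $\mathcal{M}$. Definition of $\Upsilon$: on generators, $\Upsilon(\epsilon) = \sigma(\epsilon)$ for $\epsilon \in X_{\mathcal{M}}$. For $m \in \mathcal{M} \setminus X_{\mathcal{M}}$: (i) decompose $m$ into an expression in terms of generators $\epsilon_i \in X_{\mathcal{M}}$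 and the unary maps $f$ and $g$; (ii) in this expression replace every occurrence of each $\epsilon_i$ by $\sigma(\epsilon_i)$, every occurrence of $f$ by $f'$ and every occurrence of $g$ by $g'$, obtaining an expression $\upsilon(m)$; (iii) let $\Upsilon(m)$ be the element of $\mathcal{N}$ obtained by evaluating all maps in $\upsilon(m)$. *)

theory Defs
  imports Main "HOL-Library.Countable_Set" "HOL-Library.FuncSet" "HOL-Library.Equipollence"
begin

locale magma11 =
  fixes M :: "'a set" and f g :: "'a \<Rightarrow> 'a"
  assumes nonempty: "M \<noteq> {}"
    and countable: "countable M"
    and f_closed: "f \<in> M \<rightarrow> M"
    and g_closed: "g \<in> M \<rightarrow> M"

definition magma11_morphism ::
  "'a set \<Rightarrow> ('a \<Rightarrow> 'a) \<Rightarrow> ('a \<Rightarrow> 'a) \<Rightarrow> 'b set \<Rightarrow> ('b \<Rightarrow> 'b) \<Rightarrow> ('b \<Rightarrow> 'b) \<Rightarrow> ('a \<Rightarrow> 'b) \<Rightarrow> bool"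
  where "magma11_morphism M f g N f' g' \<theta> \<longleftrightarrow>
    \<theta> \<in> M \<rightarrow> N \<and> (\<forall>m\<in>M. \<theta> (f m) = f' (\<theta> m) \<and> \<theta> (g m) = g' (\<theta> m))"

definition magma11_isomorphism ::
  "'a set \<Rightarrow> ('a \<Rightarrow> 'a) \<Rightarrow> ('a \<Rightarrow> 'a) \<Rightarrow> 'b set \<Rightarrow> ('b \<Rightarrow> 'b) \<Rightarrow> ('b \<Rightarrow> 'b) \<Rightarrow> ('a \<Rightarrow> 'b) \<Rightarrow> bool"
  where "magma11_isomorphism M f g N f' g' \<theta> \<longleftrightarrow>
    magma11_morphism M f g N f' g' \<theta> \<and> bij_betw \<theta> M N"

text \<open>
  \<open>magma11_free_on Y i M f g\<close>: the pair \<open>(Y, i)\<close> witnesses that \<open>(M, f, g)\<close> is free; the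
  generating set is then \<open>i ` Y\<close>. A definition cannot quantify over all types, so the test
  magmas \<open>N\<close> are carried by sets of natural numbers. As (1,1)-magmas are countable, every one
  is isomorphic to such a magma, and \<open>magma11_free_on_universal\<close> below recovers the universal
  property for test magmas over an arbitrary type. Since only the values on \<open>M\<close> matter, a map
  out of \<open>M\<close> is represented by an extensional function, which makes uniqueness meaningful.
\<close>
definition magma11_free_on ::
  "'y set \<Rightarrow> ('y \<Rightarrow> 'a) \<Rightarrow> 'a set \<Rightarrow> ('a \<Rightarrow> 'a) \<Rightarrow> ('a \<Rightarrow> 'a) \<Rightarrow> bool"
  where "magma11_free_on Y i M f g \<longleftrightarrow>
    magma11 M f g \<and> i \<in> Y \<rightarrow> M \<and>
    (\<forall>(N :: nat set) f' g' \<phi>. magma11 N f' g' \<longrightarrow> \<phi> \<in> Y \<rightarrow> N \<longrightarrow>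
      (\<exists>!\<theta>. \<theta> \<in> extensional M \<and> magma11_morphism M f g N f' g' \<theta> \<and> (\<forall>y\<in>Y. \<phi> y = \<theta> (i y))))"

lemma magma11_free_on_universal:
  fixes N :: "'b set"
  assumes free: "magma11_free_on Y i M f g" and N: "magma11 N f' g'" and \<phi>: "\<phi> \<in> Y \<rightarrow> N"
  shows "\<exists>!\<theta>. \<theta> \<in> extensional M \<and> magma11_morphism M f g N f' g' \<theta> \<and> (\<forall>y\<in>Y. \<phi> y = \<theta> (i y))"
proof -
  interpret M: magma11 M f g using free by (simp add: magma11_free_on_def)
  interpret N: magma11 N f' g' by (rule N)
  have i: "i \<in> Y \<rightarrow> M" using free by (simp add: magma11_free_on_def)
  define h where "h = to_nat_on N"
  have inj: "inj_on h N" unfolding h_def by (rule inj_on_to_nat_on[OF N.countable])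
  define k where "k = inv_into N h"
  have kh: "k (h n) = n" if "n \<in> N" for n
    using that inj by (simp add: k_def inv_into_f_f)
  define F where "F = (\<lambda>x. h (f' (k x)))"
  define G where "G = (\<lambda>x. h (g' (k x)))"
  have "magma11 (h ` N) F G"
    using N.nonempty N.countable N.f_closed N.g_closed
    by unfold_locales (auto simp: F_def G_def kh Pi_iff)
  moreover have "h \<circ> \<phi> \<in> Y \<rightarrow> h ` N" using \<phi> by auto
  ultimately have ex1: "\<exists>!\<theta>. \<theta> \<in> extensional M \<and> magma11_morphism M f g (h ` N) F G \<theta> \<and>
      (\<forall>y\<in>Y. (h \<circ> \<phi>) y = \<theta> (i y))"
    using free unfolding magma11_free_on_def by blast
  show ?thesis
  proof (rule ex_ex1I)
    from ex1 obtain \<theta> where \<theta>: "magma11_morphism M f g (h ` N) F G \<theta>"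
      "\<forall>y\<in>Y. (h \<circ> \<phi>) y = \<theta> (i y)" by blast
    have mem: "\<theta> m \<in> h ` N" if "m \<in> M" for m
      using \<theta>(1) that by (auto simp: magma11_morphism_def)
    have "k (\<theta> m) \<in> N" if "m \<in> M" for m
      using mem[OF that] kh by auto
    moreover have "k (\<theta> (f m)) = f' (k (\<theta> m)) \<and> k (\<theta> (g m)) = g' (k (\<theta> m))" if "m \<in> M" for m
      using \<theta>(1) that mem[OF that] N.f_closed N.g_closed kh
      by (auto simp: magma11_morphism_def F_def G_def Pi_iff)
    moreover have "\<phi> y = k (\<theta> (i y))" if "y \<in> Y" for y
    proof -
      have "\<theta> (i y) = h (\<phi> y)" using \<theta>(2) that by simp
      then show ?thesis using \<phi> that kh by (simp add: Pi_iff)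
    qed
    ultimately have "restrict (k \<circ> \<theta>) M \<in> extensional M \<and>
        magma11_morphism M f g N f' g' (restrict (k \<circ> \<theta>) M) \<and>
        (\<forall>y\<in>Y. \<phi> y = restrict (k \<circ> \<theta>) M (i y))"
      using M.f_closed M.g_closed i by (auto simp: magma11_morphism_def Pi_iff)
    then show "\<exists>\<theta>. \<theta> \<in> extensional M \<and> magma11_morphism M f g N f' g' \<theta> \<and>
        (\<forall>y\<in>Y. \<phi> y = \<theta> (i y))" by blast
  next
    fix \<theta>1 \<theta>2
    assume 1: "\<theta>1 \<in> extensional M \<and> magma11_morphism M f g N f' g' \<theta>1 \<and> (\<forall>y\<in>Y. \<phi> y = \<theta>1 (i y))"
      and 2: "\<theta>2 \<in> extensional M \<and> magma11_morphism M f g N f' g' \<theta>2 \<and> (\<forall>y\<in>Y. \<phi> y = \<theta>2 (i y))"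
    have lift: "restrict (h \<circ> \<theta>) M \<in> extensional M \<and>
        magma11_morphism M f g (h ` N) F G (restrict (h \<circ> \<theta>) M) \<and>
        (\<forall>y\<in>Y. (h \<circ> \<phi>) y = restrict (h \<circ> \<theta>) M (i y))"
      if "magma11_morphism M f g N f' g' \<theta>" "\<forall>y\<in>Y. \<phi> y = \<theta> (i y)" for \<theta>
      using that M.f_closed M.g_closed i kh
      by (auto simp: magma11_morphism_def Pi_iff F_def G_def)
    have eq: "restrict (h \<circ> \<theta>1) M = restrict (h \<circ> \<theta>2) M"
      using ex1 lift[of \<theta>1] lift[of \<theta>2] 1 2 by blast
    show "\<theta>1 = \<theta>2"
    proof (rule extensionalityI[of _ M])
      fix m assume m: "m \<in> M"
      have "h (\<theta>1 m) = h (\<theta>2 m)" using fun_cong[OF eq, of m] m by simp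
      moreover have "\<theta>1 m \<in> N" "\<theta>2 m \<in> N" using 1 2 m by (auto simp: magma11_morphism_def)
      ultimately show "\<theta>1 m = \<theta>2 m" using inj by (simp add: inj_on_eq_iff)
    qed (use 1 2 in auto)
  qed
qed

datatype (gens: 'a) magma11_expr =
  Gen 'a | AppF "'a magma11_expr" | AppG "'a magma11_expr"

primrec eval_expr :: "('a \<Rightarrow> 'a) \<Rightarrow> ('a \<Rightarrow> 'a) \<Rightarrow> 'a magma11_expr \<Rightarrow> 'a" where
  "eval_expr f g (Gen x) = x"
| "eval_expr f g (AppF e) = f (eval_expr f g e)"
| "eval_expr f g (AppG e) = g (eval_expr f g e)"

definition decomposition ::
  "'a set \<Rightarrow> ('a \<Rightarrow> 'a) \<Rightarrow> ('a \<Rightarrow> 'a) \<Rightarrow> 'a \<Rightarrow> 'a magma11_expr"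
  where "decomposition X f g m = (THE e. gens e \<subseteq> X \<and> eval_expr f g e = m)"

text \<open>
  The map \<open>\<Upsilon>\<close>. Replacing each generator \<open>\<epsilon>\<close> by \<open>\<sigma> \<epsilon>\<close> is \<open>map_magma11_expr \<sigma>\<close>; replacing
  \<open>f\<close>, \<open>g\<close> by \<open>f'\<close>, \<open>g'\<close> amounts to evaluating the expression with \<open>f'\<close>, \<open>g'\<close>.
\<close>
definition universal_bijection ::
  "'a set \<Rightarrow> ('a \<Rightarrow> 'a) \<Rightarrow> ('a \<Rightarrow> 'a) \<Rightarrow> ('b \<Rightarrow> 'b) \<Rightarrow> ('b \<Rightarrow> 'b) \<Rightarrow> ('a \<Rightarrow> 'b) \<Rightarrow> 'a \<Rightarrow> 'b"
  where "universal_bijection X f g f' g' \<sigma> m =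
    (if m \<in> X then \<sigma> m
     else eval_expr f' g' (map_magma11_expr \<sigma> (decomposition X f g m)))"

end

theory Submission imports Defs begin

text \<open>
  The point is that a free (1,1)-magma is the same thing as its set of formal expressions:
  evaluation is a bijection from the expressions over the generating set \<open>X\<close> onto \<open>M\<close>
  (\<open>free_eval_bij\<close>), and decomposition is its inverse. Granting this, \<open>\<Upsilon>\<close> is the composite of
  three bijections: decompose in \<open>M\<close>, rename the generators along \<open>\<sigma>\<close>, evaluate in \<open>N\<close>. Each
  of the three carries an application of one of the two unary maps to an application of the
  corresponding map, so the composite is a morphism as well.

  The two halves of the bijection come from the two halves of the universal property.
  Uniqueness of the induced morphism gives surjectivity: two copies of \<open>M\<close> glued along the
  submagma of values of expressions receive two morphisms from \<open>M\<close> that agree on \<open>X\<close>, and these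
  are equal only if that submagma is everything. Existence gives injectivity: a morphism from
  \<open>M\<close> to a magma of expressions that sends each generator to itself, viewed as an expression,
  recovers every expression from its value. The generators are numbered first, so
  that the target can be the magma of all expressions in natural numbers: it is countable, as
  a (1,1)-magma must be, and non-empty whether or not there are generators.
\<close>

definition exprs_over :: "'a set \<Rightarrow> 'a magma11_expr set" where
  "exprs_over X = {e. gens e \<subseteq> X}"

lemma exprs_over_simps [simp]:
  "Gen x \<in> exprs_over X \<longleftrightarrow> x \<in> X"
  "AppF e \<in> exprs_over X \<longleftrightarrow> e \<in> exprs_over X"
  "AppG e \<in> exprs_over X \<longleftrightarrow> e \<in> exprs_over X"
  by (auto simp: exprs_over_def)

lemma exprs_over_mono: "X \<subseteq> X' \<Longrightarrow> exprs_over X \<subseteq> exprs_over X'"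
  by (auto simp: exprs_over_def)

lemma (in magma11) eval_expr_in_carrier:
  "e \<in> exprs_over M \<Longrightarrow> eval_expr f g e \<in> M"
  using f_closed g_closed by (induction e) auto

lemma (in magma11) morphism_eval_expr:
  assumes "magma11_morphism M f g N f' g' \<theta>" and "e \<in> exprs_over M"
  shows "\<theta> (eval_expr f g e) = eval_expr f' g' (map_magma11_expr \<theta> e)"
  using assms(2)
proof (induction e)
  case (AppF e)
  then show ?case using assms(1) eval_expr_in_carrier[of e] by (simp add: magma11_morphism_def)
next
  case (AppG e)
  then show ?case using assms(1) eval_expr_in_carrier[of e] by (simp add: magma11_morphism_def)
qed simp

lemma map_expr_inj_on:
  assumes "inj_on h X"
  shows "inj_on (map_magma11_expr h) (exprs_over X)"
proof (rule inj_onI)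
  fix e e' assume e: "e \<in> exprs_over X" "e' \<in> exprs_over X"
    and eq: "map_magma11_expr h e = map_magma11_expr h e'"
  show "e = e'"
  proof (rule magma11_expr.inj_map_strong[OF _ eq])
    fix x x' assume "x \<in> gens e" "x' \<in> gens e'" "h x = h x'"
    with e assms show "x = x'" by (auto simp: exprs_over_def dest: inj_onD)
  qed
qed

lemma map_expr_image:
  "map_magma11_expr h ` exprs_over X = exprs_over (h ` X)"
proof
  show "map_magma11_expr h ` exprs_over X \<subseteq> exprs_over (h ` X)"
    by (fastforce simp: exprs_over_def magma11_expr.set_map)
  have "e \<in> map_magma11_expr h ` exprs_over X" if "e \<in> exprs_over (h ` X)" for e
    using that
  proof (induction e)
    case (Gen y)
    then obtain x where "x \<in> X" "y = h x" by auto
    then have "Gen y = map_magma11_expr h (Gen x)" "Gen x \<in> exprs_over X" by simp_all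
    then show ?case by (rule image_eqI)
  next
    case (AppF e)
    then obtain d where "d \<in> exprs_over X" "e = map_magma11_expr h d" by auto
    then have "AppF e = map_magma11_expr h (AppF d)" "AppF d \<in> exprs_over X" by simp_all
    then show ?case by (rule image_eqI)
  next
    case (AppG e)
    then obtain d where "d \<in> exprs_over X" "e = map_magma11_expr h d" by auto
    then have "AppG e = map_magma11_expr h (AppG d)" "AppG d \<in> exprs_over X" by simp_all
    then show ?case by (rule image_eqI)
  qed
  then show "exprs_over (h ` X) \<subseteq> map_magma11_expr h ` exprs_over X" by blast
qed

lemma map_expr_bij_betw:
  "bij_betw \<sigma> X X' \<Longrightarrow> bij_betw (map_magma11_expr \<sigma>) (exprs_over X) (exprs_over X')"
  by (auto simp: bij_betw_def map_expr_inj_on map_expr_image)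

text \<open>
  Nothing is left over besides the values of expressions over the generators. Let \<open>S\<close> be the set
  of these values. On \<open>M \<times> UNIV\<close> the flag of a pair records the copy of \<open>M\<close> to which it belongs,
  and it is reset on entering \<open>S\<close>, where the two copies are identified. Because \<open>S\<close> is closed
  under both maps, \<open>m \<mapsto> (m, m \<notin> S)\<close> is a morphism just as \<open>m \<mapsto> (m, False)\<close> is; they agree on
  the generators, hence everywhere.
\<close>
lemma free_eval_surj:
  fixes M :: "'a set"
  assumes free: "magma11_free_on Y i M f g"
  shows "M \<subseteq> eval_expr f g ` exprs_over (i ` Y)"
proof
  interpret magma11 M f g using free by (simp add: magma11_free_on_def)
  have i: "i y \<in> M" if "y \<in> Y" for y using free that by (auto simp: magma11_free_on_def)
  define S where "S = eval_expr f g ` exprs_over (i ` Y)"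
  have gen_S: "i y \<in> S" if "y \<in> Y" for y
    unfolding S_def by (rule image_eqI[of _ _ "Gen (i y)"]) (use that in auto)
  have f_S: "f m \<in> S" if "m \<in> S" for m
  proof -
    from that obtain e where "e \<in> exprs_over (i ` Y)" "m = eval_expr f g e" by (auto simp: S_def)
    then show ?thesis unfolding S_def by (intro image_eqI[of _ _ "AppF e"]) simp_all
  qed
  have g_S: "g m \<in> S" if "m \<in> S" for m
  proof -
    from that obtain e where "e \<in> exprs_over (i ` Y)" "m = eval_expr f g e" by (auto simp: S_def)
    then show ?thesis unfolding S_def by (intro image_eqI[of _ _ "AppG e"]) simp_all
  qed
  define D :: "('a \<times> bool) set" where "D = M \<times> UNIV"
  define F where "F = (\<lambda>(m, b). (f m, b \<and> f m \<notin> S))"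
  define G where "G = (\<lambda>(m, b). (g m, b \<and> g m \<notin> S))"
  have D: "magma11 D F G"
    using nonempty countable f_closed g_closed
    by unfold_locales (auto simp: D_def F_def G_def)
  define \<theta>1 where "\<theta>1 = restrict (\<lambda>m. (m, False)) M"
  define \<theta>2 where "\<theta>2 = restrict (\<lambda>m. (m, m \<notin> S)) M"
  have ex1: "\<exists>!\<theta>. \<theta> \<in> extensional M \<and> magma11_morphism M f g D F G \<theta> \<and>
      (\<forall>y\<in>Y. (i y, False) = \<theta> (i y))"
    by (rule magma11_free_on_universal[OF free D]) (auto simp: D_def i)
  have "\<theta>1 \<in> extensional M \<and> magma11_morphism M f g D F G \<theta>1 \<and> (\<forall>y\<in>Y. (i y, False) = \<theta>1 (i y))"
    using f_closed g_closed
    by (auto simp: \<theta>1_def magma11_morphism_def D_def F_def G_def i Pi_iff)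
  moreover
  have "\<theta>2 \<in> extensional M \<and> magma11_morphism M f g D F G \<theta>2 \<and> (\<forall>y\<in>Y. (i y, False) = \<theta>2 (i y))"
    using f_closed g_closed f_S g_S
    by (auto simp: \<theta>2_def magma11_morphism_def D_def F_def G_def i gen_S Pi_iff)
  ultimately have eq: "\<theta>1 = \<theta>2" using ex1 by blast
  fix m assume "m \<in> M"
  with fun_cong[OF eq, of m] have "m \<in> S" by (simp add: \<theta>1_def \<theta>2_def)
  then show "m \<in> eval_expr f g ` exprs_over (i ` Y)" by (simp add: S_def)
qed

instance magma11_expr :: (countable) countable
  by countable_datatype

text \<open>
  Let \<open>h\<close> number the generators. The morphism to the expressions in natural numbers that is
  induced by \<open>\<epsilon> \<mapsto> Gen (h \<epsilon>)\<close> takes the value of an expression \<open>e\<close> to \<open>e\<close> with its generator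
  numbered, and this determines \<open>e\<close> as \<open>h\<close> is injective.
\<close>
lemma free_eval_inj:
  assumes free: "magma11_free_on Y i M f g"
  shows "inj_on (eval_expr f g) (exprs_over (i ` Y))"
proof -
  interpret magma11 M f g using free by (simp add: magma11_free_on_def)
  have X: "i ` Y \<subseteq> M" using free by (auto simp: magma11_free_on_def)
  define h where "h = to_nat_on (i ` Y)"
  have h: "inj_on h (i ` Y)"
    unfolding h_def by (rule inj_on_to_nat_on) (rule countable_subset[OF X countable])
  have "magma11 (UNIV :: nat magma11_expr set) AppF AppG"
    by unfold_locales auto
  from magma11_free_on_universal[OF free this, of "\<lambda>y. Gen (h (i y))"]
  obtain \<theta> where \<theta>: "magma11_morphism M f g UNIV AppF AppG \<theta>"
    and \<theta>_gen: "\<And>y. y \<in> Y \<Longrightarrow> \<theta> (i y) = Gen (h (i y))" by auto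
  have \<theta>_eval: "\<theta> (eval_expr f g e) = map_magma11_expr h e" if "e \<in> exprs_over (i ` Y)" for e
  proof -
    have "\<theta> (eval_expr f g e) = eval_expr AppF AppG (map_magma11_expr \<theta> e)"
      using \<theta> that exprs_over_mono[OF X] by (blast intro: morphism_eval_expr)
    also have "\<dots> = map_magma11_expr h e"
      using that by (induction e) (auto simp: \<theta>_gen)
    finally show ?thesis .
  qed
  show ?thesis
  proof (rule inj_onI)
    fix e e' assume e: "e \<in> exprs_over (i ` Y)" "e' \<in> exprs_over (i ` Y)"
      and "eval_expr f g e = eval_expr f g e'"
    then have "map_magma11_expr h e = map_magma11_expr h e'" using \<theta>_eval by metis
    then show "e = e'" by (rule inj_onD[OF map_expr_inj_on[OF h] _ e])
  qed
qed

lemma free_eval_bij: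
  assumes free: "magma11_free_on Y i M f g"
  shows "bij_betw (eval_expr f g) (exprs_over (i ` Y)) M"
proof -
  interpret magma11 M f g using free by (simp add: magma11_free_on_def)
  have X: "i ` Y \<subseteq> M" using free by (auto simp: magma11_free_on_def)
  have "eval_expr f g ` exprs_over (i ` Y) \<subseteq> M"
    using eval_expr_in_carrier exprs_over_mono[OF X] by blast
  then show ?thesis
    using free_eval_inj[OF free] free_eval_surj[OF free] by (auto simp: bij_betw_def)
qed

lemma decomposition_eval_expr:
  assumes "inj_on (eval_expr f g) (exprs_over X)" and "e \<in> exprs_over X"
  shows "decomposition X f g (eval_expr f g e) = e"
  unfolding decomposition_def
  using assms by (intro the_equality) (auto simp: exprs_over_def inj_on_def)

text \<open>
  Generators do not form a special case in the definition of \<open>\<Upsilon>\<close>: decompositions being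
  unique, a generator decomposes as itself. The resulting equation says that \<open>\<Upsilon>\<close> is the renaming of generators, transported along
  the two evaluation maps.
\<close>
lemma universal_bijection_eval_expr:
  assumes "inj_on (eval_expr f g) (exprs_over X)" and "e \<in> exprs_over X"
  shows "universal_bijection X f g f' g' \<sigma> (eval_expr f g e) =
    eval_expr f' g' (map_magma11_expr \<sigma> e)"
proof (cases "eval_expr f g e \<in> X")
  case True
  then have "e = Gen (eval_expr f g e)"
    using decomposition_eval_expr[OF assms]
      decomposition_eval_expr[OF assms(1), of "Gen (eval_expr f g e)"] by simp
  with True show ?thesis
    by (metis universal_bijection_def magma11_expr.map(1) eval_expr.simps(1))
next
  case False
  then show ?thesis
    by (simp add: universal_bijection_def decomposition_eval_expr[OF assms])
qed

theorem proposition9: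
  fixes M :: "'a set" and f g :: "'a \<Rightarrow> 'a"
    and N :: "'b set" and f' g' :: "'b \<Rightarrow> 'b"
    and Y :: "'y set" and i :: "'y \<Rightarrow> 'a"
    and Z :: "'z set" and j :: "'z \<Rightarrow> 'b"
    and X\<^sub>M :: "'a set" and X\<^sub>N :: "'b set"
    and \<sigma> :: "'a \<Rightarrow> 'b"
  assumes "magma11_free_on Y i M f g" and "X\<^sub>M = i ` Y"
    and "magma11_free_on Z j N f' g'" and "X\<^sub>N = j ` Z"
    and "X\<^sub>M \<approx> X\<^sub>N"
    and "bij_betw \<sigma> X\<^sub>M X\<^sub>N"
  shows "magma11_isomorphism M f g N f' g' (universal_bijection X\<^sub>M f g f' g' \<sigma>)"
proof -
  let ?E = "exprs_over X\<^sub>M" and ?\<Upsilon> = "universal_bijection X\<^sub>M f g f' g' \<sigma>"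
  have M: "bij_betw (eval_expr f g) ?E M"
    using free_eval_bij[OF assms(1)] assms(2) by simp
  have N: "bij_betw (eval_expr f' g') (exprs_over X\<^sub>N) N"
    using free_eval_bij[OF assms(3)] assms(4) by simp
  have \<Upsilon>: "?\<Upsilon> (eval_expr f g e) = eval_expr f' g' (map_magma11_expr \<sigma> e)" if "e \<in> ?E" for e
    using universal_bijection_eval_expr bij_betw_imp_inj_on[OF M] that .
  have "bij_betw (eval_expr f' g' \<circ> map_magma11_expr \<sigma>) ?E N"
    using map_expr_bij_betw[OF assms(6)] N by (rule bij_betw_trans)
  then have "bij_betw (?\<Upsilon> \<circ> eval_expr f g) ?E N"
    by (rule bij_betw_cong[THEN iffD1, rotated]) (simp add: \<Upsilon>)
  then have bij: "bij_betw ?\<Upsilon> M N"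
    using bij_betw_comp_iff[OF M] by blast
  have "?\<Upsilon> (f m) = f' (?\<Upsilon> m) \<and> ?\<Upsilon> (g m) = g' (?\<Upsilon> m)" if "m \<in> M" for m
  proof -
    obtain e where e: "e \<in> ?E" and m: "m = eval_expr f g e"
      using \<open>m \<in> M\<close> bij_betw_imp_surj_on[OF M] by blast
    show ?thesis using \<Upsilon>[of e] \<Upsilon>[of "AppF e"] \<Upsilon>[of "AppG e"] e by (simp add: m)
  qed
  with bij show ?thesis
    by (auto simp: magma11_isomorphism_def magma11_morphism_def bij_betw_def)
qed

end
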